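(* Consider the single-item pricing problem under stationary demand with $b$ units of starting inventory to sell over $T$ periods, and suppose Assumption C holds. Then for at least one of the two choices $s^*\in\{\lfloor s_{\mathsf H}\rfloor,\lceil s_{\mathsf H}\rceil\}$, the calendar of Algorithm 5 earns expected revenue at least $$\frac{\mathbb{E}[\min\{\mathrm{Bin}(T,b/T),b\}]}{b}\cdot\mathsf{OPT}_{\mathrm{LP}},$$ where $\mathsf{OPT}_{\mathrm{LP}}$ is the optimal value of DLP-S.
   Context: Single-item pricing with stationary demand: one item with starting inventory $b$ ($1\le b\le T$, real) is sold over $T$ periods at prices $p_1,\dots,p_m>0$. If price $p_j$ is offered in a period, the demanded quantity is a random variable in $[0,1]$ with CDF $F_j$, independent across periods; sales equal the minimum of the demand and the remaining inventory, earning $p_j$ per unit. (Bernoulli demand is a special case.) Let $q_j$ be the mean of $F_j$. DLP-S: maximize $T\sum_{j}p_jq_jx_j$ subject to $T\sum_jq_jx_j\le b$, $\sum_jx_j\le1$, $x_j\ge0$. This LP has a basic optimal solution with at most two nonzero entries, denoted $x^*_{\mathsf H}$ and $x^*_{\mathsf L}$ at prices $p_{\mathsf H}\ge p_{\mathsf L}$. Algorithm 5: take such a solution, let $s_{\mathsf H}=T x^*_{\mathsf H}/(x^*_{\mathsf H}+x^*_{\mathsf L})$, and offer $p_{\mathsf H}$ in periods $t=1,\dots,s^*$ and $p_{\mathsf L}$ in periods $t=s^*+1,\dots,T$, where $s^*$ is $\lfloor s_{\mathsf H}\rfloor$ or $\lceil s_{\mathsf H}\rceil$. Assumption C: for any $j,j'\in[m]$,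 either $F_j(x)\ge F_{j'}(x)$ for all $x\in[0,1]$, or $F_j(x)\le F_{j'}(x)$ for all $x\in[0,1]$. $\mathrm{Bin}(T,\rho)$ is a Binomial random variable. *)

theory Defs
  imports "HOL-Probability.Probability"
begin

definition dlp_feasible :: "real \<Rightarrow> nat \<Rightarrow> ('m::finite \<Rightarrow> real) \<Rightarrow> (real ^ 'm) set" where
  "dlp_feasible b T q =
     {x. real T * (\<Sum>j\<in>UNIV. q j * x $ j) \<le> b \<and> (\<Sum>j\<in>UNIV. x $ j) \<le> 1 \<and> (\<forall>j. 0 \<le> x $ j)}"

definition dlp_objective :: "nat \<Rightarrow> ('m::finite \<Rightarrow> real) \<Rightarrow> ('m \<Rightarrow> real) \<Rightarrow> real ^ 'm \<Rightarrow> real" where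
  "dlp_objective T p q x = real T * (\<Sum>j\<in>UNIV. p j * q j * x $ j)"

definition dlp_value :: "real \<Rightarrow> nat \<Rightarrow> ('m::finite \<Rightarrow> real) \<Rightarrow> ('m \<Rightarrow> real) \<Rightarrow> real" where
  "dlp_value b T p q = (SUP x\<in>dlp_feasible b T q. dlp_objective T p q x)"

definition dlp_optimal ::
    "real \<Rightarrow> nat \<Rightarrow> ('m::finite \<Rightarrow> real) \<Rightarrow> ('m \<Rightarrow> real) \<Rightarrow> real ^ 'm \<Rightarrow> bool" where
  "dlp_optimal b T p q x \<longleftrightarrow> x \<in> dlp_feasible b T q \<and>
     (\<forall>y\<in>dlp_feasible b T q. dlp_objective T p q y \<le> dlp_objective T p q x)"

(* A point is a basic solution if as many linearly independent constraints as there are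
   variables hold with equality, i.e. if the normals of the tight constraints span the space. *)
definition dlp_tight_normals ::
    "real \<Rightarrow> nat \<Rightarrow> ('m::finite \<Rightarrow> real) \<Rightarrow> real ^ 'm \<Rightarrow> (real ^ 'm) set" where
  "dlp_tight_normals b T q x =
     (if real T * (\<Sum>j\<in>UNIV. q j * x $ j) = b then {\<chi> j. real T * q j} else {}) \<union>
     (if (\<Sum>j\<in>UNIV. x $ j) = 1 then {\<chi> j. 1} else {}) \<union>
     {axis j 1 |j. x $ j = 0}"

definition dlp_basic :: "real \<Rightarrow> nat \<Rightarrow> ('m::finite \<Rightarrow> real) \<Rightarrow> real ^ 'm \<Rightarrow> bool" where
  "dlp_basic b T q x \<longleftrightarrow> span (dlp_tight_normals b T q x) = UNIV"

(* Periods are numbered from 0; d t is the demand in period t, and inventory b d t is what is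
   left of the initial stock b at the beginning of period t. *)
primrec inventory :: "real \<Rightarrow> (nat \<Rightarrow> real) \<Rightarrow> nat \<Rightarrow> real" where
  "inventory b d 0 = b"
| "inventory b d (Suc t) = inventory b d t - min (d t) (inventory b d t)"

definition revenue ::
    "real \<Rightarrow> nat \<Rightarrow> ('m \<Rightarrow> real) \<Rightarrow> (nat \<Rightarrow> 'm) \<Rightarrow> (nat \<Rightarrow> real) \<Rightarrow> real" where
  "revenue b T p c d = (\<Sum>t<T. p (c t) * min (d t) (inventory b d t))"

(* The product measure makes demands independent across periods; the demand in period t has
   the distribution belonging to the price c t offered then. *)
definition expected_revenue ::
    "real \<Rightarrow> nat \<Rightarrow> ('m \<Rightarrow> real) \<Rightarrow> ('m \<Rightarrow> real measure) \<Rightarrow> (nat \<Rightarrow> 'm) \<Rightarrow> real" where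
  "expected_revenue b T p D c =
     (\<integral>d. revenue b T p c d \<partial>(PiM {..<T} (\<lambda>t. D (c t))))"

definition two_price_calendar :: "nat \<Rightarrow> 'm \<Rightarrow> 'm \<Rightarrow> nat \<Rightarrow> 'm" where
  "two_price_calendar s H L t = (if t < s then H else L)"

end

theory Submission
  imports Defs
begin

text \<open>Write \<open>S\<close> for total demand and \<open>S\<^sub>H\<close> for the demand in the high-price periods.
  The revenue is \<open>p\<^sub>L min S b + (p\<^sub>H - p\<^sub>L) min S\<^sub>H b\<close>, so both terms are expectations of a
  concave function of a sum of independent \<open>[0,1]\<close>-valued variables. Such an expectation decreases
  when every variable is replaced by a Bernoulli variable of the same mean, and decreases further
  when all success probabilities are replaced by their average (Hoeffding). Choosing \<open>s\<^sup>*\<close>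
  at random between floor and ceiling with mean \<open>s\<^sub>H\<close> changes the demand of at most one period into
  a mixture, and gives \<open>S\<close> and \<open>S\<^sub>H\<close> at least the means prescribed by the LP. It remains
  to compare binomial variables with different success probabilities, which is done by thinning.
  The better of the two deterministic choices is at least as good as the random one.\<close>

section \<open>Expectations of Bernoulli sums as iterated operators\<close>

text \<open>Adding one Bernoulli variable acts as an operator on functions. Sums then correspond to
  compositions of such operators, and comparing them takes algebra and induction rather than measure
  theory.\<close>

definition bernoulli_step :: "real \<Rightarrow> (real \<Rightarrow> real) \<Rightarrow> real \<Rightarrow> real" where
  "bernoulli_step p f z = (1 - p) * f z + p * f (z + 1)"

text \<open>The expectation of \<open>f (z + B)\<close>, where \<open>B\<close> is a sum of independent Bernoulli variables
  with success probabilities \<open>r 0, \<dots>, r (n - 1)\<close>.\<close>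

primrec poisson_binomial :: "(nat \<Rightarrow> real) \<Rightarrow> nat \<Rightarrow> (real \<Rightarrow> real) \<Rightarrow> real \<Rightarrow> real" where
  "poisson_binomial r 0 f = f"
| "poisson_binomial r (Suc n) f = poisson_binomial r n (bernoulli_step (r n) f)"

lemma bernoulli_step_mono:
  assumes "p \<in> {0..1}" and "\<And>z. f z \<le> g z"
  shows "bernoulli_step p f z \<le> bernoulli_step p g z"
  using assms by (auto simp: bernoulli_step_def intro!: add_mono mult_left_mono)

lemma bernoulli_step_prob_mono:
  assumes "mono f" and "p \<le> p'"
  shows "bernoulli_step p f z \<le> bernoulli_step p' f z"
proof -
  have "0 \<le> (p' - p) * (f (z + 1) - f z)"
    using assms by (simp add: monoD)
  then show ?thesis by (simp add: bernoulli_step_def algebra_simps)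
qed

lemma mono_bernoulli_step:
  assumes "p \<in> {0..1}" and "mono f"
  shows "mono (bernoulli_step p f)"
  using assms by (auto simp: bernoulli_step_def mono_def intro!: add_mono mult_left_mono)

lemma concave_bernoulli_step:
  assumes "p \<in> {0..1}" and "concave_on UNIV f"
  shows "concave_on UNIV (bernoulli_step p f)"
proof -
  have shift: "concave_on UNIV (\<lambda>z. f (z + 1))"
  proof (rule concave_on_linorderI)
    fix t x y :: real
    assume "t > 0" "t < 1"
    then have "(1 - t) * f (x + 1) + t * f (y + 1) \<le> f ((1 - t) *\<^sub>R (x + 1) + t *\<^sub>R (y + 1))"
      by (intro concave_onD[OF assms(2)]) auto
    then show "(1 - t) * f (x + 1) + t * f (y + 1) \<le> f ((1 - t) *\<^sub>R x + t *\<^sub>R y + 1)"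
      by (simp add: algebra_simps)
  qed simp
  show ?thesis
    unfolding bernoulli_step_def[abs_def]
    using assms by (intro concave_on_add concave_on_cmul shift) auto
qed

text \<open>The left side is the value at \<open>z + y\<close> of the chord joining the graph of
  \<open>f\<close> at \<open>z\<close> and \<open>z + 1\<close>.\<close>

lemma concave_bernoulli_step_le:
  assumes "concave_on UNIV f" and "y \<in> {0..1}"
  shows "bernoulli_step y f z \<le> f (z + y)"
  using concave_onD[OF assms(1), of y z "z + 1"] assms(2)
  by (simp add: bernoulli_step_def algebra_simps)

lemma concave_midpoint:
  fixes f :: "real \<Rightarrow> real"
  assumes "concave_on UNIV f"
  shows "f z + f (z + 2) \<le> 2 * f (z + 1)"
proof -
  have "(1 - 1/2) *\<^sub>R z + (1/2) *\<^sub>R (z + 2) = z + 1" by (simp add: field_simps)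
  then show ?thesis
    using concave_onD[OF assms, of "1/2" z "z + 2"] by simp
qed

lemma poisson_binomial_mono:
  assumes "\<And>t. t < n \<Longrightarrow> r t \<in> {0..1}" and "\<And>z. f z \<le> g z"
  shows "poisson_binomial r n f z \<le> poisson_binomial r n g z"
  using assms
proof (induction n arbitrary: f g)
  case (Suc n)
  then show ?case
    by (auto intro!: Suc.IH bernoulli_step_mono simp del: atLeastAtMost_iff)
qed simp

lemma poisson_binomial_linear:
  "poisson_binomial r n (\<lambda>z. a * f z + c * g z) z =
     a * poisson_binomial r n f z + c * poisson_binomial r n g z"
proof (induction n arbitrary: f g)
  case (Suc n)
  have "bernoulli_step (r n) (\<lambda>z. a * f z + c * g z) =
      (\<lambda>z. a * bernoulli_step (r n) f z + c * bernoulli_step (r n) g z)"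
    by (simp add: bernoulli_step_def fun_eq_iff algebra_simps)
  then show ?case using Suc by simp
qed simp

lemma poisson_binomial_bernoulli_step:
  "poisson_binomial r n (bernoulli_step p f) z =
     (1 - p) * poisson_binomial r n f z + p * poisson_binomial r n (\<lambda>z. f (z + 1)) z"
  unfolding bernoulli_step_def[abs_def] by (rule poisson_binomial_linear)

lemma poisson_binomial_prob_mono:
  assumes "mono f" and "\<And>t. t < n \<Longrightarrow> r t \<in> {0..1}" and "\<And>t. t < n \<Longrightarrow> r' t \<in> {0..1}"
    and "\<And>t. t < n \<Longrightarrow> r t \<le> r' t"
  shows "poisson_binomial r n f z \<le> poisson_binomial r' n f z"
  using assms
proof (induction n arbitrary: f)
  case (Suc n)
  have "poisson_binomial r n (bernoulli_step (r n) f) z \<le> poisson_binomial r n (bernoulli_step (r' n) f) z"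
    using Suc.prems by (intro poisson_binomial_mono bernoulli_step_prob_mono) auto
  also have "\<dots> \<le> poisson_binomial r' n (bernoulli_step (r' n) f) z"
    using Suc.prems by (intro Suc.IH mono_bernoulli_step) auto
  finally show ?case by simp
qed simp

lemma poisson_binomial_cong:
  assumes "\<And>t. t < n \<Longrightarrow> r t = r' t"
  shows "poisson_binomial r n f = poisson_binomial r' n f"
  using assms by (induction n arbitrary: f) auto

text \<open>The expectation is affine in each single success probability, so it commutes with mixing
  when only the probability with index \<open>k\<close> varies.\<close>

lemma poisson_binomial_mixture:
  assumes "\<And>t. t < n \<Longrightarrow> t \<noteq> k \<Longrightarrow> r t = r' t"
  shows "poisson_binomial (\<lambda>t. (1 - \<theta>) * r t + \<theta> * r' t) n f z =
     (1 - \<theta>) * poisson_binomial r n f z + \<theta> * poisson_binomial r' n f z"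
  using assms
proof (induction n arbitrary: f)
  case (Suc n)
  show ?case
  proof (cases "n = k")
    case True
    have r': "poisson_binomial r' n f = poisson_binomial r n f"
      and m: "poisson_binomial (\<lambda>t. (1 - \<theta>) * r t + \<theta> * r' t) n f = poisson_binomial r n f" for f
      using Suc.prems True by (auto intro!: poisson_binomial_cong simp: algebra_simps)
    show ?thesis
      by (simp only: poisson_binomial.simps r' m poisson_binomial_bernoulli_step)
        (simp add: algebra_simps)
  next
    case False
    then have "r n = r' n" using Suc.prems by simp
    then have "(1 - \<theta>) * r n + \<theta> * r' n = r n" by (simp add: algebra_simps)
    then show ?thesis using Suc.IH Suc.prems \<open>r n = r' n\<close> by simp
  qed
qed (simp add: algebra_simps)

section \<open>Hoeffding's inequality: averaging the success probabilities\<close>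

text \<open>Two steps depend on their probabilities only through the sum and the product, and the
  product multiplies the second difference of \<open>f\<close>, which is nonpositive. Evening out a
  pair thus lowers the expectation.\<close>

lemma bernoulli_step_balance:
  assumes "concave_on UNIV f" and "p + r = p' + r'" and "p * r \<le> p' * r'"
  shows "bernoulli_step p' (bernoulli_step r' f) z \<le> bernoulli_step p (bernoulli_step r f) z"
proof -
  have expand: "bernoulli_step u (bernoulli_step v f) z =
      f z + (u + v) * (f (z + 1) - f z) - u * v * (2 * f (z + 1) - f z - f (z + 2))" for u v
    by (simp add: bernoulli_step_def algebra_simps)
  have "0 \<le> 2 * f (z + 1) - f z - f (z + 2)"
    using concave_midpoint[OF assms(1), of z] by simp
  with assms(3) show ?thesis
    unfolding expand assms(2) by (simp add: mult_right_mono)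
qed

lemma average_in_unit_interval:
  fixes p m :: real
  assumes "p \<in> {0..1}" "m \<in> {0..1}"
  shows "(p + real n * m) / real (Suc n) \<in> {0..1}"
proof -
  have "real n * m \<le> real n * 1" using assms by (intro mult_left_mono) auto
  then show ?thesis using assms by (auto simp: field_simps)
qed

text \<open>Moving one of the \<open>n\<close> equal probabilities \<open>m\<close> to the overall mean \<open>\<mu>\<close> and \<open>p\<close> to
  \<open>p + m - \<mu>\<close> brings the two closer together, and leaves a problem with one probability less.\<close>

lemma poisson_binomial_average_last:
  assumes "concave_on UNIV f" and "p \<in> {0..1}" and "m \<in> {0..1}"
    and "\<mu> = (p + real n * m) / real (Suc n)"
  shows "poisson_binomial (\<lambda>_. \<mu>) (Suc n) f z \<le> poisson_binomial (\<lambda>_. m) n (bernoulli_step p f) z"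
  using assms
proof (induction n arbitrary: f p)
  case (Suc n)
  define p' where "p' = p + m - \<mu>"
  define N where "N = real n"
  have N: "N \<ge> 0" by (simp add: N_def)
  have \<mu>: "(N + 2) * \<mu> = p + (N + 1) * m"
    using Suc.prems(4) by (simp add: N_def field_simps)
  have "\<mu> \<in> {0..1}"
    unfolding Suc.prems(4) using Suc.prems(2,3) by (rule average_in_unit_interval)
  have p'_eq: "p' = ((N + 1) * p + m) / (N + 2)"
    using \<mu> N by (simp add: p'_def field_simps)
  have "p' \<in> {0..1}"
  proof -
    have "(N + 1) * p \<le> (N + 1) * 1" "(N + 1) * p \<ge> 0"
      using N Suc.prems(2) by (auto intro!: mult_left_mono)
    then show ?thesis
      using N Suc.prems(3) unfolding p'_eq by (auto simp: field_simps)
  qed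
  \<comment> \<open>The mean of \<open>p'\<close> and the remaining \<open>n\<close> copies of
    \<open>m\<close> is still \<open>\<mu>\<close>, so the induction hypothesis produces the same
    \<open>\<mu>\<close>.\<close>
  have \<mu>': "\<mu> = (p' + real n * m) / real (Suc n)"
    using \<mu> N unfolding p'_def N_def by (simp add: field_simps)
  \<comment> \<open>The difference \<open>p' * \<mu> - m * p\<close> factors as
    \<open>(\<mu> - p) * (m - \<mu>)\<close>, which is nonnegative because \<open>\<mu>\<close> lies
    between \<open>p\<close> and \<open>m\<close>.\<close>
  have "\<mu> - p = (N + 1) * (m - \<mu>)"
    using \<mu> by (simp add: algebra_simps)
  then have "(\<mu> - p) * (m - \<mu>) = (N + 1) * (m - \<mu>)\<^sup>2"
    by (simp add: power2_eq_square)
  then have "0 \<le> (\<mu> - p) * (m - \<mu>)" using N by simp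
  then have prod: "m * p \<le> p' * \<mu>"
    by (simp add: p'_def algebra_simps)
  have "poisson_binomial (\<lambda>_. \<mu>) (Suc (Suc n)) f z =
      poisson_binomial (\<lambda>_. \<mu>) (Suc n) (bernoulli_step \<mu> f) z" by simp
  also have "\<dots> \<le> poisson_binomial (\<lambda>_. m) n (bernoulli_step p' (bernoulli_step \<mu> f)) z"
    using Suc.prems \<open>\<mu> \<in> {0..1}\<close> \<open>p' \<in> {0..1}\<close> \<mu>' by (intro Suc.IH concave_bernoulli_step) auto
  also have "\<dots> \<le> poisson_binomial (\<lambda>_. m) n (bernoulli_step m (bernoulli_step p f)) z"
    using Suc.prems prod
    by (intro poisson_binomial_mono bernoulli_step_balance) (auto simp: p'_def)
  finally show ?case by simp
qed simp

lemma poisson_binomial_Hoeffding: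
  assumes "concave_on UNIV f" and "\<And>t. t < n \<Longrightarrow> r t \<in> {0..1}"
  shows "poisson_binomial (\<lambda>_. (\<Sum>t<n. r t) / real n) n f z \<le> poisson_binomial r n f z"
  using assms
proof (induction n arbitrary: f)
  case (Suc n)
  \<comment> \<open>For \<open>n = 0\<close> division by zero gives \<open>m = 0\<close>, and the
    facts below remain true.\<close>
  define m where "m = (\<Sum>t<n. r t) / real n"
  have nm: "real n * m = (\<Sum>t<n. r t)" by (simp add: m_def)
  have "(\<Sum>t<n. r t) \<le> (\<Sum>t<n. 1)" using Suc.prems by (intro sum_mono) auto
  moreover have "(\<Sum>t<n. r t) \<ge> 0" using Suc.prems by (intro sum_nonneg) auto
  ultimately have m: "m \<in> {0..1}" by (auto simp: m_def divide_le_eq)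
  have "poisson_binomial (\<lambda>_. (\<Sum>t<Suc n. r t) / real (Suc n)) (Suc n) f z
      \<le> poisson_binomial (\<lambda>_. m) n (bernoulli_step (r n) f) z"
    using Suc.prems m nm by (intro poisson_binomial_average_last) (auto simp: add.commute)
  also have "\<dots> \<le> poisson_binomial r n (bernoulli_step (r n) f) z"
    unfolding m_def using Suc.prems by (intro Suc.IH concave_bernoulli_step) auto
  finally show ?case by simp
qed simp

section \<open>Thinning and comparison of binomial expectations\<close>

text \<open>Meant for the unit increment \<open>g\<close> of a concave function; the sum moves only
  in unit steps, along which \<open>g\<close> decreases.\<close>

lemma poisson_binomial_le:
  assumes "p \<in> {0..1}" and "\<And>z. g (z + 1) \<le> g z"
  shows "poisson_binomial (\<lambda>_. p) n g z \<le> g z"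
proof (induction n)
  case (Suc n)
  have "bernoulli_step p g y \<le> g y" for y
    using mult_left_mono[OF assms(2)[of y], of p] assms(1)
    by (simp add: bernoulli_step_def algebra_simps)
  then have "poisson_binomial (\<lambda>_. p) n (bernoulli_step p g) z \<le> poisson_binomial (\<lambda>_. p) n g z"
    using assms(1) by (intro poisson_binomial_mono) auto
  then show ?case using Suc by simp
qed simp

text \<open>A binomial variable with probability \<open>\<theta> p\<close> is compared with the mixture that equals
  \<open>Bin n p\<close> with probability \<open>\<theta>\<close> and \<open>0\<close> otherwise.\<close>

lemma poisson_binomial_thinning:
  assumes "concave_on UNIV f" and "p \<in> {0..1}" and "\<theta> \<in> {0..1}"
  shows "(1 - \<theta>) * f z + \<theta> * poisson_binomial (\<lambda>_. p) n f z
    \<le> poisson_binomial (\<lambda>_. \<theta> * p) n f z"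
  using assms
proof (induction n arbitrary: f z)
  case (Suc n)
  let ?B = "poisson_binomial (\<lambda>_. p) n"
  define g where "g z = f (z + 1) - f z" for z
  have \<theta>p: "\<theta> * p \<in> {0..1}" using Suc.prems by (auto simp: mult_le_one)
  have g_antimono: "g (z + 1) \<le> g z" for z
    using concave_midpoint[OF Suc.prems(1), of z] by (simp add: g_def add.commute)
  \<comment> \<open>The factor \<open>1\<close> gives the right side the shape required by
    \<open>poisson_binomial_linear\<close>.\<close>
  have step: "bernoulli_step u f = (\<lambda>z. 1 * f z + u * g z)" for u
    by (simp add: fun_eq_iff bernoulli_step_def g_def algebra_simps)
  \<comment> \<open>After expansion by linearity, this product is exactly the right side minus the
    left side of the next inequality.\<close>
  have "0 \<le> \<theta> * (1 - \<theta>) * p * (g z - ?B g z)"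
    using Suc.prems poisson_binomial_le[of p g n z] g_antimono by auto
  then have "(1 - \<theta>) * f z + \<theta> * ?B (bernoulli_step p f) z
      \<le> (1 - \<theta>) * bernoulli_step (\<theta> * p) f z + \<theta> * ?B (bernoulli_step (\<theta> * p) f) z"
    unfolding step poisson_binomial_linear by (simp add: algebra_simps)
  also have "\<dots> \<le> poisson_binomial (\<lambda>_. \<theta> * p) n (bernoulli_step (\<theta> * p) f) z"
    using Suc.prems \<theta>p by (intro Suc.IH concave_bernoulli_step)
  finally show ?case by simp
qed (simp add: algebra_simps)

text \<open>Thinning with factor \<open>c / b\<close> passes from probability \<open>b / n\<close>
  to \<open>c / n\<close>; the weight on \<open>f 0 = 0\<close> contributes nothing. Monotonicity
  raises \<open>c / n\<close> to the mean of the \<open>r t\<close>, and Hoeffding replaces the mean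
  by the \<open>r t\<close> themselves.\<close>

lemma poisson_binomial_lower_bound:
  assumes f: "concave_on UNIV f" "mono f" "f 0 = 0"
    and r: "\<And>t. t < n \<Longrightarrow> r t \<in> {0..1}"
    and b: "0 < b" "b \<le> real n"
    and c: "0 \<le> c" "c \<le> b" "c \<le> (\<Sum>t<n. r t)"
  shows "c / b * poisson_binomial (\<lambda>_. b / real n) n f 0 \<le> poisson_binomial r n f 0"
proof -
  have n: "real n > 0" using b by linarith
  have "(\<Sum>t<n. r t) \<le> (\<Sum>t<n. 1)" using r by (intro sum_mono) auto
  then have m: "(\<Sum>t<n. r t) / real n \<in> {0..1}" using c n by (auto simp: divide_le_eq)
  have "c / b * poisson_binomial (\<lambda>_. b / real n) n f 0
      \<le> poisson_binomial (\<lambda>_. c / b * (b / real n)) n f 0"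
    using poisson_binomial_thinning[OF f(1), of "b / real n" "c / b" 0 n] b c n f(3)
    by (auto simp: divide_le_eq)
  also have "\<dots> = poisson_binomial (\<lambda>_. c / real n) n f 0" using b by simp
  also have "\<dots> \<le> poisson_binomial (\<lambda>_. (\<Sum>t<n. r t) / real n) n f 0"
    using f(2) m c b n by (intro poisson_binomial_prob_mono) (auto simp: divide_right_mono divide_le_eq)
  also have "\<dots> \<le> poisson_binomial r n f 0"
    using f(1) r by (rule poisson_binomial_Hoeffding)
  finally show ?thesis .
qed

section \<open>Link to the binomial distribution\<close>

lemma expectation_binomial_pmf_eq_poisson_binomial:
  assumes "p \<in> {0..1}"
  shows "measure_pmf.expectation (binomial_pmf n p) (\<lambda>k. f (z + real k)) =
    poisson_binomial (\<lambda>_. p) n f z"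
proof (induction n arbitrary: z)
  case 0
  then show ?case using assms by (simp add: binomial_pmf_0)
next
  case (Suc n)
  have fin: "finite (set_pmf (binomial_pmf n p))"
    using assms by (simp add: set_pmf_binomial_eq)
  \<comment> \<open>\<open>binomial_pmf_Suc\<close> adds the new trial to the starting point, the
    operator recursion adds it to the argument of \<open>f\<close>; this identifies the two.\<close>
  have shift: "poisson_binomial (\<lambda>_. p) n f (z + 1) = poisson_binomial (\<lambda>_. p) n (\<lambda>z. f (z + 1)) z" for z
  proof (induction n arbitrary: f)
    case (Suc n)
    then show ?case by (simp add: bernoulli_step_def[abs_def])
  qed simp
  have "measure_pmf.expectation (binomial_pmf (Suc n) p) (\<lambda>k. f (z + real k)) =
    (\<Sum>a\<in>UNIV. pmf (bernoulli_pmf p) a *\<^sub>R measure_pmf.expectation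
       (map_pmf (\<lambda>k. (if a then 1 else 0) + k) (binomial_pmf n p)) (\<lambda>k. f (z + real k)))"
    unfolding binomial_pmf_Suc[OF assms] map_pmf_def[symmetric]
    using fin by (intro pmf_expectation_bind) auto
  also have "\<dots> = (1 - p) * measure_pmf.expectation (binomial_pmf n p) (\<lambda>k. f (z + real k)) +
      p * measure_pmf.expectation (binomial_pmf n p) (\<lambda>k. f ((z + 1) + real k))"
    using assms by (simp add: UNIV_bool add.assoc)
  also have "\<dots> = poisson_binomial (\<lambda>_. p) (Suc n) f z"
    by (simp add: Suc shift poisson_binomial_bernoulli_step)
  finally show ?case .
qed

section \<open>From demands in [0,1] to Bernoulli demands\<close>

lemma expectation_in_unit_interval:
  assumes "prob_space M" and "X \<in> borel_measurable M" and "AE y in M. X y \<in> {0..1::real}"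
  shows "integrable M X" and "(\<integral>y. X y \<partial>M) \<in> {0..1}"
proof -
  interpret prob_space M by fact
  show int: "integrable M X"
    using assms(3) by (intro integrable_const_bound[where B = 1] assms(2)) auto
  have "(\<integral>y. X y \<partial>M) \<le> (\<integral>y. 1 \<partial>M)"
    using assms(3) int by (intro integral_mono_AE) auto
  moreover have "0 \<le> (\<integral>y. X y \<partial>M)"
    using assms(3) by (intro integral_nonneg_AE) auto
  ultimately show "(\<integral>y. X y \<partial>M) \<in> {0..1}" by (simp add: prob_space)
qed

text \<open>The maps \<open>X t\<close> let one product measure carry both the total demand and the
  high-price demand, where later coordinates are sent to 0.\<close>

lemma integrable_mono_unit_sum:
  fixes X :: "nat \<Rightarrow> 'a \<Rightarrow> real" and f :: "real \<Rightarrow> real"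
  assumes M: "\<And>t. prob_space (M t)"
    and X: "\<And>t. X t \<in> borel_measurable (M t)" "\<And>t. AE y in M t. X t y \<in> {0..1}"
    and f: "mono f"
  shows "integrable (PiM {..<n} M) (\<lambda>d. f (z + (\<Sum>t<n. X t (d t))))"
proof -
  interpret prob_space "PiM {..<n} M" by (intro prob_space_PiM M)
  have [measurable]: "f \<in> borel_measurable borel" using f by (rule borel_measurable_mono)
  note X(1)[measurable]
  show ?thesis
  proof (rule integrable_const_bound)
    have "AE d in PiM {..<n} M. \<forall>t\<in>{..<n}. X t (d t) \<in> {0..1}"
      using M X(2) by (intro AE_finite_allI AE_PiM_component) auto
    then show "AE d in PiM {..<n} M. norm (f (z + (\<Sum>t<n. X t (d t)))) \<le> \<bar>f z\<bar> + \<bar>f (z + real n)\<bar>"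
    proof eventually_elim
      case (elim d)
      then have "0 \<le> (\<Sum>t<n. X t (d t))" by (intro sum_nonneg) auto
      moreover have "(\<Sum>t<n. X t (d t)) \<le> (\<Sum>t<n. 1)" using elim by (intro sum_mono) auto
      ultimately have "f z \<le> f (z + (\<Sum>t<n. X t (d t)))" "f (z + (\<Sum>t<n. X t (d t))) \<le> f (z + real n)"
        by (auto intro!: monoD[OF f])
      then show ?case by auto
    qed
  qed measurable
qed

text \<open>In the concave order, the Bernoulli distribution is the smallest one on \<open>[0,1]\<close> of given mean.\<close>

lemma expectation_concave_unit_sum_ge:
  fixes X :: "nat \<Rightarrow> 'a \<Rightarrow> real" and f :: "real \<Rightarrow> real"
  assumes M: "\<And>t. prob_space (M t)"
    and X: "\<And>t. X t \<in> borel_measurable (M t)" "\<And>t. AE y in M t. X t y \<in> {0..1}"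
    and f: "concave_on UNIV f" "mono f"
  shows "poisson_binomial (\<lambda>t. \<integral>y. X t y \<partial>M t) n f z
    \<le> (\<integral>d. f (z + (\<Sum>t<n. X t (d t))) \<partial>PiM {..<n} M)"
  using f
proof (induction n arbitrary: f)
  case 0
  interpret prob_space "PiM {} M" by (intro prob_space_PiM M)
  show ?case by (simp add: PiM_empty prob_space)
next
  case (Suc n)
  interpret S: product_sigma_finite M
    by (intro product_sigma_finite.intro prob_space_imp_sigma_finite M)
  interpret P: prob_space "PiM {..<n} M" by (intro prob_space_PiM M)
  interpret N: prob_space "M n" by (rule M)
  define \<mu> where "\<mu> = (\<integral>y. X n y \<partial>M n)"
  have \<mu>: "\<mu> \<in> {0..1}" and int_X: "integrable (M n) (X n)"
    using expectation_in_unit_interval[OF M X] by (auto simp: \<mu>_def)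
  have meas[measurable]: "f \<in> borel_measurable borel" using Suc.prems by (intro borel_measurable_mono)
  note X(1)[measurable]
  have int: "integrable (PiM {..<Suc n} M) (\<lambda>d. f (z + (\<Sum>t<Suc n. X t (d t))))"
    by (rule integrable_mono_unit_sum[OF M X Suc.prems(2)])
  have sum_upd: "(\<Sum>t<n. X t ((d(n := y)) t)) = (\<Sum>t<n. X t (d t))" for d y
    by (rule sum.cong) auto
  \<comment> \<open>The chord of \<open>f\<close> over \<open>[a, a + 1]\<close> is affine, so
    integrating it along \<open>X n\<close> involves only the mean \<open>\<mu>\<close>.\<close>
  have inner: "bernoulli_step \<mu> f a \<le> (\<integral>y. f (a + X n y) \<partial>M n)" for a
  proof -
    have "bernoulli_step \<mu> f a = (\<integral>y. f a + X n y * (f (a + 1) - f a) \<partial>M n)"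
      using int_X by (simp add: \<mu>_def bernoulli_step_def N.prob_space algebra_simps)
    also have "\<dots> \<le> (\<integral>y. f (a + X n y) \<partial>M n)"
    proof (rule integral_mono_AE)
      show "integrable (M n) (\<lambda>y. f a + X n y * (f (a + 1) - f a))" using int_X by auto
      show "integrable (M n) (\<lambda>y. f (a + X n y))"
      proof (rule N.integrable_const_bound)
        show "AE y in M n. norm (f (a + X n y)) \<le> \<bar>f a\<bar> + \<bar>f (a + 1)\<bar>"
          using X(2)[of n]
        proof eventually_elim
          case (elim y)
          then have "f a \<le> f (a + X n y)" "f (a + X n y) \<le> f (a + 1)"
            by (auto intro!: monoD[OF Suc.prems(2)])
          then show ?case by auto
        qed
      qed measurable
      show "AE y in M n. f a + X n y * (f (a + 1) - f a) \<le> f (a + X n y)"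
        using X(2)[of n]
      proof eventually_elim
        case (elim y)
        then show ?case
          using concave_bernoulli_step_le[OF Suc.prems(1), of "X n y" a]
          by (simp add: bernoulli_step_def algebra_simps)
      qed
    qed
    finally show ?thesis .
  qed
  \<comment> \<open>The induction hypothesis, taken at \<open>bernoulli_step \<mu> f\<close>, treats
    the first \<open>n\<close> variables; \<open>inner\<close> then treats the last one, and Fubini
    reassembles the product.\<close>
  have "poisson_binomial (\<lambda>t. \<integral>y. X t y \<partial>M t) (Suc n) f z
      \<le> (\<integral>d. bernoulli_step \<mu> f (z + (\<Sum>t<n. X t (d t))) \<partial>PiM {..<n} M)"
    using Suc.IH[OF concave_bernoulli_step mono_bernoulli_step] Suc.prems \<mu> by (simp add: \<mu>_def)
  also have "\<dots> \<le> (\<integral>d. (\<integral>y. f (z + (\<Sum>t<n. X t (d t)) + X n y) \<partial>M n) \<partial>PiM {..<n} M)"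
  proof (rule integral_mono_AE)
    show "integrable (PiM {..<n} M) (\<lambda>d. bernoulli_step \<mu> f (z + (\<Sum>t<n. X t (d t))))"
      using \<mu> Suc.prems by (intro integrable_mono_unit_sum[OF M X] mono_bernoulli_step)
    show "integrable (PiM {..<n} M) (\<lambda>d. \<integral>y. f (z + (\<Sum>t<n. X t (d t)) + X n y) \<partial>M n)"
    proof (rule P.integrable_const_bound)
      have "AE d in PiM {..<n} M. \<forall>t\<in>{..<n}. X t (d t) \<in> {0..1}"
        using M X(2) by (intro AE_finite_allI AE_PiM_component) auto
      then show "AE d in PiM {..<n} M. norm (\<integral>y. f (z + (\<Sum>t<n. X t (d t)) + X n y) \<partial>M n)
          \<le> \<bar>f z\<bar> + \<bar>f (z + real (Suc n))\<bar>"
      proof eventually_elim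
        case (elim d)
        let ?s = "\<Sum>t<n. X t (d t)"
        have s: "0 \<le> ?s" "?s \<le> (\<Sum>t<n. 1)"
          using elim by (auto intro!: sum_nonneg sum_mono simp del: sum_constant)
        have bound: "AE y in M n. norm (f (z + ?s + X n y)) \<le> \<bar>f z\<bar> + \<bar>f (z + real (Suc n))\<bar>"
          using X(2)[of n]
        proof eventually_elim
          case (elim y)
          then have "f z \<le> f (z + ?s + X n y)" "f (z + ?s + X n y) \<le> f (z + real (Suc n))"
            using s by (auto intro!: monoD[OF Suc.prems(2)])
          then show ?case by auto
        qed
        have "norm (\<integral>y. f (z + ?s + X n y) \<partial>M n) \<le> (\<integral>y. norm (f (z + ?s + X n y)) \<partial>M n)"
          by (rule integral_norm_bound)
        also have "\<dots> \<le> (\<integral>y. \<bar>f z\<bar> + \<bar>f (z + real (Suc n))\<bar> \<partial>M n)"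
          using bound by (intro integral_mono_AE N.integrable_const integrable_norm
              N.integrable_const_bound[OF bound]) auto
        finally show ?case by (simp add: N.prob_space)
      qed
    qed measurable
  qed (simp add: inner)
  also have "\<dots> = (\<integral>d. f (z + (\<Sum>t<Suc n. X t (d t))) \<partial>PiM {..<Suc n} M)"
  proof -
    have "integrable (PiM (insert n {..<n}) M) (\<lambda>d. f (z + (\<Sum>t<n. X t (d t)) + X n (d n)))"
      using int by (simp add: lessThan_Suc ac_simps)
    from S.product_integral_insert[OF _ _ this] show ?thesis
      by (simp add: sum_upd lessThan_Suc ac_simps del: fun_upd_apply add: fun_upd_same)
  qed
  finally show ?case .
qed

section \<open>Revenue of a two-price calendar\<close>

lemma concave_on_min_const: "concave_on UNIV (\<lambda>z::real. min z b)"
proof (rule concave_on_linorderI)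
  fix t x y :: real
  assume t: "t > 0" "t < 1"
  have "(1 - t) * min x b + t * min y b \<le> (1 - t) * x + t * y"
    and "(1 - t) * min x b + t * min y b \<le> (1 - t) * b + t * b"
    using t by (auto intro!: add_mono mult_left_mono)
  then show "(1 - t) * min x b + t * min y b \<le> min ((1 - t) *\<^sub>R x + t *\<^sub>R y) b"
    by (simp add: algebra_simps)
qed simp

lemma mono_min_const: "mono (\<lambda>z::real. min z b)"
  by (auto simp: mono_def)

lemma inventory_eq:
  assumes "0 \<le> b" and "\<And>i. i < t \<Longrightarrow> 0 \<le> d i"
  shows "inventory b d t = b - min (\<Sum>i<t. d i) b"
  using assms(2)
proof (induction t)
  case (Suc t)
  then have "0 \<le> d t" and "inventory b d t = b - min (\<Sum>i<t. d i) b" by auto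
  then show ?case by (auto simp: min_def)
qed (use assms(1) in simp)

text \<open>Sales in a period are the increment of cumulative demand capped at \<open>b\<close>, so
  they telescope. Every sold unit earns \<open>p L\<close>, and those sold in the first
  \<open>s\<close> periods earn the premium \<open>p H - p L\<close> as well.\<close>

lemma revenue_two_price_calendar:
  assumes "0 \<le> b" and "\<And>t. t < T \<Longrightarrow> 0 \<le> d t"
  shows "revenue b T p (two_price_calendar s H L) d =
    p L * min (\<Sum>t<T. d t) b + (p H - p L) * min (\<Sum>t<T. if t < s then d t else 0) b"
  using assms(2)
proof (induction T)
  case 0
  then show ?case using assms(1) by (simp add: revenue_def)
next
  case (Suc n)
  let ?S = "\<Sum>t<n. d t"
  have "0 \<le> d n" using Suc.prems by simp
  moreover have "inventory b d n = b - min ?S b"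
    using assms(1) Suc.prems by (simp add: inventory_eq)
  ultimately have sales: "min (d n) (inventory b d n) = min (?S + d n) b - min ?S b"
    by (auto simp: min_def)
  have same: "(\<Sum>t<n. if t < s then d t else 0) = ?S" if "n < s"
    using that by (intro sum.cong) auto
  have "revenue b (Suc n) p (two_price_calendar s H L) d = revenue b n p (two_price_calendar s H L) d
      + p (two_price_calendar s H L n) * (min (?S + d n) b - min ?S b)"
    by (simp add: revenue_def sales)
  moreover have "two_price_calendar s H L n = (if n < s then H else L)"
    by (simp add: two_price_calendar_def)
  ultimately show ?case
    using Suc same by (cases "n < s") (simp_all add: algebra_simps)
qed

text \<open>Both coefficients in the revenue formula are nonnegative, so the Bernoulli bound applies
  to each capped sum separately.\<close>

lemma expected_revenue_two_price_calendar_ge: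
  fixes p q :: "'m \<Rightarrow> real" and D :: "'m \<Rightarrow> real measure"
  assumes b: "0 \<le> b" and price: "p L \<le> p H" "0 \<le> p L"
    and D: "\<And>j. real_distribution (D j)" "\<And>j. AE y in D j. y \<in> {0..1}"
    and q: "\<And>j. q j = (\<integral>y. y \<partial>D j)"
  shows "p L * poisson_binomial (\<lambda>t. if t < s then q H else q L) T (\<lambda>z. min z b) 0
      + (p H - p L) * poisson_binomial (\<lambda>t. if t < s then q H else 0) T (\<lambda>z. min z b) 0
    \<le> expected_revenue b T p D (two_price_calendar s H L)"
proof -
  let ?M = "\<lambda>t. D (two_price_calendar s H L t)"
  let ?P = "PiM {..<T} ?M"
  let ?f = "\<lambda>z. min z b"
  let ?X = "\<lambda>t y::real. if t < s then y else 0"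
  have M: "prob_space (?M t)" for t using D(1) by (rule real_distribution.axioms)
  have sets: "sets (D j) = sets borel" for j
    using D(1) by (rule real_distribution.events_eq_borel)
  have id: "(\<lambda>y. y) \<in> borel_measurable (?M t)" for t
    by (simp add: measurable_cong_sets[OF sets refl])
  have X: "?X t \<in> borel_measurable (?M t)" for t
    using id[of t] by simp
  have X_unit: "AE y in ?M t. ?X t y \<in> {0..1}" for t
    using D(2) by simp
  have int: "integrable ?P (\<lambda>d. ?f (\<Sum>t<T. d t))"
    using integrable_mono_unit_sum[where M = ?M and X = "\<lambda>_ y. y" and z = 0, OF M id D(2) mono_min_const] by simp
  have int': "integrable ?P (\<lambda>d. ?f (\<Sum>t<T. ?X t (d t)))"
    using integrable_mono_unit_sum[where M = ?M and X = "?X" and z = 0, OF M X X_unit mono_min_const] by simp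
  have "expected_revenue b T p D (two_price_calendar s H L) =
      (\<integral>d. p L * ?f (\<Sum>t<T. d t) + (p H - p L) * ?f (\<Sum>t<T. ?X t (d t)) \<partial>?P)"
    unfolding expected_revenue_def
  proof (rule integral_cong_AE)
    have "AE d in ?P. \<forall>t\<in>{..<T}. d t \<in> {0..1}"
      using M D(2) by (intro AE_finite_allI AE_PiM_component) auto
    then show eq: "AE d in ?P. revenue b T p (two_price_calendar s H L) d =
        p L * ?f (\<Sum>t<T. d t) + (p H - p L) * ?f (\<Sum>t<T. ?X t (d t))"
      by eventually_elim (use b in \<open>auto intro!: revenue_two_price_calendar\<close>)
    show "(\<lambda>d. p L * ?f (\<Sum>t<T. d t) + (p H - p L) * ?f (\<Sum>t<T. ?X t (d t))) \<in> borel_measurable ?P"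
      using int int' by auto
    have comp: "(\<lambda>d. d t) \<in> borel_measurable ?P" if "t < T" for t
      using measurable_component_singleton[of t "{..<T}" ?M] that
      by (simp add: measurable_cong_sets[OF refl sets])
    have inv: "(\<lambda>d. inventory b d t) \<in> borel_measurable ?P" if "t \<le> T" for t
      using that by (induction t) (auto intro!: borel_measurable_diff borel_measurable_min comp)
    show "revenue b T p (two_price_calendar s H L) \<in> borel_measurable ?P"
      unfolding revenue_def[abs_def]
      by (intro borel_measurable_sum borel_measurable_times borel_measurable_const
          borel_measurable_min comp inv) auto
  qed
  also have "\<dots> = p L * (\<integral>d. ?f (\<Sum>t<T. d t) \<partial>?P)
      + (p H - p L) * (\<integral>d. ?f (\<Sum>t<T. ?X t (d t)) \<partial>?P)"
    using int int' by simp
  also have "\<dots> \<ge> p L * poisson_binomial (\<lambda>t. if t < s then q H else q L) T ?f 0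
      + (p H - p L) * poisson_binomial (\<lambda>t. if t < s then q H else 0) T ?f 0"
  proof (intro add_mono mult_left_mono)
    have "(\<lambda>t. \<integral>y. y \<partial>?M t) = (\<lambda>t. if t < s then q H else q L)"
      by (auto simp: q two_price_calendar_def)
    then show "poisson_binomial (\<lambda>t. if t < s then q H else q L) T ?f 0 \<le> (\<integral>d. ?f (\<Sum>t<T. d t) \<partial>?P)"
      using expectation_concave_unit_sum_ge[where M = ?M and X = "\<lambda>_ y. y" and z = 0,
          OF M id D(2) concave_on_min_const mono_min_const]
      by simp
    have "(\<lambda>t. \<integral>y. ?X t y \<partial>?M t) = (\<lambda>t. if t < s then q H else 0)"
      by (auto simp: q two_price_calendar_def)
    then show "poisson_binomial (\<lambda>t. if t < s then q H else 0) T ?f 0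
        \<le> (\<integral>d. ?f (\<Sum>t<T. ?X t (d t)) \<partial>?P)"
      using expectation_concave_unit_sum_ge[where M = ?M and X = "?X" and z = 0,
          OF M X X_unit concave_on_min_const mono_min_const]
      by simp
  qed (use price in auto)
  finally show ?thesis .
qed

section \<open>Two-price solutions of the linear program\<close>

text \<open>The LP objective splits like the revenue, with \<open>c\<close> and \<open>c\<^sub>H\<close> in place of the total sales
  and the sales at the high price.\<close>

lemma two_price_dlp_decomposition:
  fixes x :: "real ^ 'm::finite"
  assumes x: "x \<in> dlp_feasible b T q" and supp: "{j. x $ j \<noteq> 0} \<subseteq> {H, L}"
    and q: "\<And>j. 0 \<le> q j" and s_H: "s_H = real T * x $ H / (x $ H + x $ L)"
  obtains c c\<^sub>H where "0 \<le> c" "c \<le> b" "c \<le> s_H * q H + (real T - s_H) * q L"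
    and "0 \<le> c\<^sub>H" "c\<^sub>H \<le> b" "c\<^sub>H \<le> s_H * q H"
    and "dlp_objective T p q x = p L * c + (p H - p L) * c\<^sub>H"
    and "0 \<le> s_H" "s_H \<le> real T"
proof -
  define c where "c = real T * (\<Sum>j\<in>UNIV. q j * x $ j)"
  \<comment> \<open>If \<open>H = L\<close>, then \<open>s_H\<close> is at most \<open>T / 2\<close>
    and \<open>T * q H * x $ H\<close> may exceed \<open>s_H * q H\<close>. The premium is zero in
    that case, so \<open>0\<close> serves.\<close>
  define c\<^sub>H where "c\<^sub>H = (if H = L then 0 else real T * (q H * x $ H))"
  define \<sigma> where "\<sigma> = x $ H + x $ L"
  have nonneg: "0 \<le> x $ j" for j
    using x by (simp add: dlp_feasible_def)
  have cap: "c \<le> b" and total: "(\<Sum>j\<in>UNIV. x $ j) \<le> 1"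
    using x by (auto simp: dlp_feasible_def c_def)
  have restrict: "(\<Sum>j\<in>UNIV. g j * x $ j) = (\<Sum>j\<in>{H, L}. g j * x $ j)" for g
    using supp by (intro sum.mono_neutral_right) auto
  have c: "c = real T * (\<Sum>j\<in>{H, L}. q j * x $ j)"
    unfolding c_def restrict ..
  have mass: "(\<Sum>j\<in>{H, L}. x $ j) \<le> 1"
    using total restrict[of "\<lambda>_. 1"] by simp
  have obj: "dlp_objective T p q x = p L * c + (p H - p L) * c\<^sub>H"
    unfolding dlp_objective_def restrict c
    by (cases "H = L") (auto simp: c\<^sub>H_def algebra_simps)
  have "x $ H \<le> \<sigma>" "0 \<le> \<sigma>" using nonneg by (auto simp: \<sigma>_def)
  then have frac: "0 \<le> x $ H / \<sigma>" "x $ H / \<sigma> \<le> 1"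
    using nonneg[of H] by (auto simp: divide_le_eq)
  have s: "s_H = real T * (x $ H / \<sigma>)" by (simp add: s_H \<sigma>_def)
  have s_bounds: "0 \<le> s_H" "s_H \<le> real T"
    using mult_left_mono[OF frac(1), of "real T"] mult_left_mono[OF frac(2), of "real T"]
    by (auto simp: s)
  have "0 \<le> c" unfolding c using nonneg q by (intro mult_nonneg_nonneg sum_nonneg) auto
  have "0 \<le> c\<^sub>H" using nonneg q by (simp add: c\<^sub>H_def)
  have "c\<^sub>H \<le> c"
    unfolding c c\<^sub>H_def using nonneg q by (auto intro!: mult_left_mono)
  have "c \<le> s_H * q H + (real T - s_H) * q L \<and> c\<^sub>H \<le> s_H * q H"
  proof (cases "H = L")
    case True
    then have "real T * (q L * x $ L) \<le> real T * (q L * 1)"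
      using mass q by (intro mult_left_mono) auto
    then show ?thesis
      using True s_bounds q by (simp add: c c\<^sub>H_def algebra_simps)
  next
    case False
    then have "\<sigma> \<le> 1" using mass by (simp add: \<sigma>_def)
    \<comment> \<open>Dividing by the total share \<open>\<sigma> \<le> 1\<close> spreads the two
      prices over the whole horizon. If \<open>\<sigma> = 0\<close>, both shares vanish and the
      quotient is \<open>0\<close> by convention.\<close>
    have scale: "x $ j \<le> x $ j / \<sigma>" if "j \<in> {H, L}" for j
    proof (cases "\<sigma> = 0")
      case True
      then show ?thesis using nonneg[of H] nonneg[of L] that by (auto simp: \<sigma>_def)
    next
      case False
      then show ?thesis
        using \<open>0 \<le> \<sigma>\<close> \<open>\<sigma> \<le> 1\<close> nonneg[of j] by (simp add: le_divide_eq mult_left_le)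
    qed
    have H: "real T * x $ H \<le> s_H"
      unfolding s using scale by (intro mult_left_mono) auto
    have L: "real T * x $ L \<le> real T - s_H"
    proof (cases "\<sigma> = 0")
      case True
      then have "x $ L = 0" using nonneg[of H] nonneg[of L] unfolding \<sigma>_def by linarith
      then show ?thesis using s_bounds by simp
    next
      case False
      then have L_frac: "x $ L / \<sigma> = 1 - x $ H / \<sigma>" by (simp add: \<sigma>_def field_simps)
      have "real T * x $ L \<le> real T * (x $ L / \<sigma>)"
        using scale by (intro mult_left_mono) auto
      also have "\<dots> = real T - s_H" unfolding L_frac s right_diff_distrib by simp
      finally show ?thesis .
    qed
    show ?thesis
      using mult_right_mono[OF H q[of H]] mult_right_mono[OF L q[of L]] False
      by (simp add: c c\<^sub>H_def algebra_simps)
  qed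
  then show ?thesis
    using that[OF \<open>0 \<le> c\<close> cap _ \<open>0 \<le> c\<^sub>H\<close> order_trans[OF \<open>c\<^sub>H \<le> c\<close> cap] _ obj s_bounds] by blast
qed

lemma dlp_value_eq:
  assumes "dlp_optimal b T p q x"
  shows "dlp_value b T p q = dlp_objective T p q x"
  unfolding dlp_value_def using assms
  by (intro cSup_eq_maximum) (auto simp: dlp_optimal_def)

section \<open>Rounding the switching time and the revenue guarantee\<close>

lemma floor_ceiling_average:
  fixes x :: real
  shows "(1 - frac x) * \<lfloor>x\<rfloor> + frac x * \<lceil>x\<rceil> = x"
proof (cases "x \<in> \<int>")
  case False
  then have "\<lceil>x\<rceil> = \<lfloor>x\<rfloor> + 1" by (simp add: ceiling_altdef Ints_def) (metis rangeI)
  then show ?thesis by (simp add: frac_def algebra_simps)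
qed (auto elim!: Ints_cases)

lemma sum_threshold:
  assumes "s \<le> T"
  shows "(\<Sum>t<T. if t < s then a else c) = real s * a + (real T - real s) * (c::real)"
proof -
  have "{..<T} \<inter> {t. t < s} = {..<s}" "{..<T} \<inter> - {t. t < s} = {s..<T}" using assms by auto
  then show ?thesis using assms by (simp add: sum.If_cases)
qed

theorem theorem5:
  fixes T :: nat and b :: real
    and p q :: "'m::finite \<Rightarrow> real" and D :: "'m \<Rightarrow> real measure"
    and x :: "real ^ 'm" and H L :: 'm and s_H :: real
  assumes b: "1 \<le> b" "b \<le> real T"
    and price_pos: "\<And>j. p j > 0"
    and distr: "\<And>j. real_distribution (D j)"
    and unit_demand: "\<And>j. AE y in D j. y \<in> {0..1}"
    and mean: "\<And>j. q j = (\<integral>y. y \<partial>D j)"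
    and assumption_C: "\<And>j j'. (\<forall>y\<in>{0..1}. cdf (D j) y \<ge> cdf (D j') y) \<or>
                               (\<forall>y\<in>{0..1}. cdf (D j) y \<le> cdf (D j') y)"
    and optimal: "dlp_optimal b T p q x"
    and basic: "dlp_basic b T q x"
    and support: "{j. x $ j \<noteq> 0} \<subseteq> {H, L}"
    and high_low: "p H \<ge> p L"
    and s_H: "s_H = real T * x $ H / (x $ H + x $ L)"
  shows "\<exists>s\<in>{nat \<lfloor>s_H\<rfloor>, nat \<lceil>s_H\<rceil>}.
           expected_revenue b T p D (two_price_calendar s H L)
             \<ge> measure_pmf.expectation (binomial_pmf T (b / real T)) (\<lambda>k. min (real k) b) / b
                 * dlp_value b T p q"
proof -
  define f where "f z = min z b" for z
  have f: "concave_on UNIV f" "mono f" "f 0 = 0"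
    using b concave_on_min_const[of b] mono_min_const[of b] by (auto simp: f_def[abs_def])
  define \<Phi> where "\<Phi> = poisson_binomial (\<lambda>_. b / real T) T f 0"
  have \<Phi>: "measure_pmf.expectation (binomial_pmf T (b / real T)) (\<lambda>k. min (real k) b) = \<Phi>"
    using expectation_binomial_pmf_eq_poisson_binomial[of "b / real T" T f 0] b
    by (auto simp: \<Phi>_def f_def divide_le_eq)
  have q: "q j \<in> {0..1}" for j
    unfolding mean using distr
    by (intro expectation_in_unit_interval(2) unit_demand real_distribution.axioms)
      (auto simp: measurable_cong_sets[OF real_distribution.events_eq_borel refl])
  obtain c c\<^sub>H where c: "0 \<le> c" "c \<le> b" "c \<le> s_H * q H + (real T - s_H) * q L"
    and c\<^sub>H: "0 \<le> c\<^sub>H" "c\<^sub>H \<le> b" "c\<^sub>H \<le> s_H * q H"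
    and obj: "dlp_objective T p q x = p L * c + (p H - p L) * c\<^sub>H"
    and s_bounds: "0 \<le> s_H" "s_H \<le> real T"
    using two_price_dlp_decomposition[where b = b and q = q and p = p, OF _ support _ s_H] optimal q
    by (auto simp: dlp_optimal_def)
  \<comment> \<open>The probability with which the randomized switching time is the ceiling.\<close>
  define \<theta> where "\<theta> = frac s_H"
  define s\<^sub>0 where "s\<^sub>0 = nat \<lfloor>s_H\<rfloor>"
  define s\<^sub>1 where "s\<^sub>1 = nat \<lceil>s_H\<rceil>"
  have \<theta>: "0 \<le> \<theta>" "\<theta> \<le> 1" by (auto simp: \<theta>_def less_imp_le[OF frac_lt_1])
  have s_le: "s\<^sub>0 \<le> T" "s\<^sub>1 \<le> T"
    using s_bounds by (auto simp: s\<^sub>0_def s\<^sub>1_def nat_le_iff floor_le_iff ceiling_le_iff)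
  have average: "(1 - \<theta>) * real s\<^sub>0 + \<theta> * real s\<^sub>1 = s_H"
    using floor_ceiling_average[of s_H] s_bounds by (simp add: \<theta>_def s\<^sub>0_def s\<^sub>1_def)
  \<comment> \<open>Since periods start at 0, the two calendars can differ only in period
    \<open>s\<^sub>0\<close>; this is the index \<open>k\<close> of the mixture lemma.\<close>
  have s_step: "t < s\<^sub>0 \<longleftrightarrow> t < s\<^sub>1" if "t \<noteq> s\<^sub>0" for t
    using that s_bounds by (auto simp: s\<^sub>0_def s\<^sub>1_def) linarith+
  \<comment> \<open>The parameter \<open>a\<close> is the mean used after the switch:
    \<open>q L\<close> for total demand, \<open>0\<close> for high-price demand.\<close>
  define r where "r a s t = (if t < s then q H else a)" for a and s t :: nat
  define mix where "mix a t = (1 - \<theta>) * r a s\<^sub>0 t + \<theta> * r a s\<^sub>1 t" for a t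
  have PB_mix: "poisson_binomial (mix a) T f 0 =
      (1 - \<theta>) * poisson_binomial (r a s\<^sub>0) T f 0 + \<theta> * poisson_binomial (r a s\<^sub>1) T f 0" for a
    unfolding mix_def[abs_def]
    by (rule poisson_binomial_mixture[where k = s\<^sub>0]) (simp add: r_def s_step)
  have mix_unit: "mix a t \<in> {0..1}" if "a \<in> {0..1}" for a t
  proof -
    have "r a s t \<in> {0..1}" for s using that q by (simp add: r_def)
    then show ?thesis
      using \<theta> convexD[OF convex_real_interval(5)[of 0 1], of "r a s\<^sub>0 t" "r a s\<^sub>1 t" "1 - \<theta>" \<theta>]
      by (simp add: mix_def)
  qed
  have sum_mix: "(\<Sum>t<T. mix a t) = s_H * q H + (real T - s_H) * a" for a
  proof -
    have "(\<Sum>t<T. mix a t) = (1 - \<theta>) * (real s\<^sub>0 * q H + (real T - real s\<^sub>0) * a)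
        + \<theta> * (real s\<^sub>1 * q H + (real T - real s\<^sub>1) * a)"
      using s_le by (simp add: mix_def r_def sum.distrib sum_threshold flip: sum_distrib_left)
    also have "\<dots> = ((1 - \<theta>) * real s\<^sub>0 + \<theta> * real s\<^sub>1) * q H
        + (real T - ((1 - \<theta>) * real s\<^sub>0 + \<theta> * real s\<^sub>1)) * a"
      by (simp add: algebra_simps)
    finally show ?thesis unfolding average .
  qed
  define V where "V s = p L * poisson_binomial (r (q L) s) T f 0
    + (p H - p L) * poisson_binomial (r 0 s) T f 0" for s
  have V: "V s \<le> expected_revenue b T p D (two_price_calendar s H L)" for s
    unfolding V_def r_def[abs_def] f_def[abs_def]
    using b less_imp_le[OF price_pos]
    by (intro expected_revenue_two_price_calendar_ge high_low distr unit_demand mean) auto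
  have "\<Phi> / b * dlp_value b T p q = p L * (c / b * \<Phi>) + (p H - p L) * (c\<^sub>H / b * \<Phi>)"
    unfolding dlp_value_eq[OF optimal] obj using b by (simp add: field_simps)
  \<comment> \<open>The lower bound is used once with \<open>c\<close> and \<open>a = q L\<close>,
    once with \<open>c\<^sub>H\<close> and \<open>a = 0\<close>; by \<open>sum_mix\<close> the means
    are the upper bounds on \<open>c\<close> and \<open>c\<^sub>H\<close> from the LP.\<close>
  also have "\<dots> \<le> p L * poisson_binomial (mix (q L)) T f 0 + (p H - p L) * poisson_binomial (mix 0) T f 0"
    unfolding \<Phi>_def using f b c c\<^sub>H high_low less_imp_le[OF price_pos] q
    by (intro add_mono mult_left_mono poisson_binomial_lower_bound mix_unit) (auto simp: sum_mix)
  also have "\<dots> = (1 - \<theta>) * V s\<^sub>0 + \<theta> * V s\<^sub>1"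
    unfolding PB_mix V_def by (simp add: algebra_simps)
  also have "\<dots> \<le> max (V s\<^sub>0) (V s\<^sub>1)"
    using \<theta> by (intro convex_bound_le) auto
  finally have "\<exists>s\<in>{s\<^sub>0, s\<^sub>1}. \<Phi> / b * dlp_value b T p q \<le> V s" by (auto simp: le_max_iff_disj)
  then show ?thesis
    unfolding \<Phi> s\<^sub>0_def s\<^sub>1_def using V order_trans by blast
qed

end
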